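(* Let $G$ be a graph with $\mathrm{Mad}(G) < \frac{8}{3}$ and $g(G)\ge 6$. Then there exists a vertex partition $V(G) = F \,\dot{\cup}\, I_1 \,\dot{\cup}\, I_2 \,\dot{\cup}\, I_3$ such that: (P1) $F$ induces a forest in $G$; and (P2) for each $i\in\{1,2,3\}$, $I_i$ is an independent set such that for all distinct $x,y \in I_i$, $d_G(x,y)> 2$.
   Context: Graphs are finite and simple. The maximum average degree is $\mathrm{Mad}(G)=\max\{2|E(H)|/|V(H)| : H\subseteq G\}$, the maximum being over subgraphs $H$ with at least one vertex. The girth $g(G)$ is the length of a shortest cycle in $G$ (with $g(G)=\infty$ if $G$ has no cycle). $d_G(x,y)$ is the distance in $G$ between $x$ and $y$ (the number of edges of a shortest path; infinite if there is none). $\dot\cup$ denotes disjoint union; parts of the partition may be empty. *)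

theory Defs
  imports "Graph_Theory.Graph_Theory" "HOL-Library.Extended_Nat"
begin

text \<open>
  A finite simple graph is a digraph satisfying the locale predicate \<^const>\<open>graph\<close>: finite,
  loop-free, without parallel arcs, and symmetric. Each undirected edge \<open>{u, v}\<close> is thus
  represented by exactly two arcs, one from \<open>u\<close> to \<open>v\<close> and one from \<open>v\<close> to \<open>u\<close>.
\<close>

definition edges :: "('a, 'b) pre_digraph \<Rightarrow> 'a set set" where
  "edges G = (\<lambda>e. {tail G e, head G e}) ` arcs G"

text \<open>
  In a subgraph of a graph, an undirected edge must be kept or deleted as a whole, hence the
  requirement that \<open>H\<close> be a graph as well.
  The value 0 for the graph without vertices is a convention: there the maximum is over the
  empty set.
\<close>

definition mad :: "('a, 'b) pre_digraph \<Rightarrow> real" where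
  "mad G = (if verts G = {} then 0
     else Max {2 * real (card (edges H)) / real (card (verts H)) | H.
                 graph H \<and> subgraph H G \<and> verts H \<noteq> {}})"

text \<open>
  \<^const>\<open>pre_digraph.cycle\<close> also admits the closed walk \<open>u, v, u\<close> that runs along an undirected
  edge and back; the length bound excludes it. For the same reason \<^const>\<open>forest\<close>, which
  forbids every \<^const>\<open>pre_digraph.cycle\<close>, is not the undirected notion: a symmetric digraph
  satisfies it only if it has no arcs.
\<close>

definition undirected_cycle :: "('a, 'b) pre_digraph \<Rightarrow> 'b awalk \<Rightarrow> bool" where
  "undirected_cycle G p \<longleftrightarrow> pre_digraph.cycle G p \<and> 3 \<le> length p"

definition undirected_forest :: "('a, 'b) pre_digraph \<Rightarrow> bool" where
  "undirected_forest G \<longleftrightarrow> \<not> (\<exists>p. undirected_cycle G p)"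

text \<open>The infimum of the empty set is \<open>\<infinity>\<close>.\<close>

definition girth :: "('a, 'b) pre_digraph \<Rightarrow> enat" where
  "girth G = (INF p \<in> {p. undirected_cycle G p}. enat (length p))"

text \<open>With unit weights the cost of a walk is its number of arcs.\<close>

definition graph_dist :: "('a, 'b) pre_digraph \<Rightarrow> 'a \<Rightarrow> 'a \<Rightarrow> ereal" where
  "graph_dist G x y = wf_digraph.\<mu> G (\<lambda>_. 1) x y"

definition independent_set :: "('a, 'b) pre_digraph \<Rightarrow> 'a set \<Rightarrow> bool" where
  "independent_set G S \<longleftrightarrow> S \<subseteq> verts G \<and> (\<forall>x\<in>S. \<forall>y\<in>S. \<not> x \<rightarrow>\<^bsub>G\<^esub> y)"

text \<open>The maximum defining \<^const>\<open>mad\<close> is over a finite set, nonempty if \<open>G\<close> has a vertex.\<close>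

lemma finite_subgraphs:
  assumes "fin_digraph G"
  shows "finite {H. subgraph H G}"
proof -
  interpret fin_digraph G by fact
  let ?f = "\<lambda>(V, A). \<lparr>verts = V, arcs = A, tail = tail G, head = head G\<rparr>"
  have "{H. subgraph H G} \<subseteq> ?f ` (Pow (verts G) \<times> Pow (arcs G))"
  proof
    fix H assume "H \<in> {H. subgraph H G}"
    then have H: "verts H \<subseteq> verts G" "arcs H \<subseteq> arcs G" "tail H = tail G" "head H = head G"
      by (simp_all add: subgraph_def compatible_def)
    then have "H = ?f (verts H, arcs H)"
      by simp
    moreover have "(verts H, arcs H) \<in> Pow (verts G) \<times> Pow (arcs G)"
      using H by simp
    ultimately show "H \<in> ?f ` (Pow (verts G) \<times> Pow (arcs G))"
      by (rule image_eqI)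
  qed
  then show ?thesis
    by (rule finite_subset) simp
qed

lemma mad_set:
  assumes "graph G"
  shows "finite {2 * real (card (edges H)) / real (card (verts H)) | H.
                   graph H \<and> subgraph H G \<and> verts H \<noteq> {}}" (is "finite ?M")
    and "verts G \<noteq> {} \<Longrightarrow>
         {2 * real (card (edges H)) / real (card (verts H)) | H.
            graph H \<and> subgraph H G \<and> verts H \<noteq> {}} \<noteq> {}"
proof -
  interpret graph G by fact
  have "?M \<subseteq> (\<lambda>H. 2 * real (card (edges H)) / real (card (verts H))) ` {H. subgraph H G}"
    by blast
  then show "finite ?M"
    by (rule finite_subset) (rule finite_imageI[OF finite_subgraphs[OF fin_digraph_axioms]])
  show "?M \<noteq> {}" if "verts G \<noteq> {}"
    using that assms subgraph_refl by blast
qed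

end

theory Submission
  imports Defs
begin

text \<open>
  Take a counterexample whose vertex set is minimal; colour 0 stands for the forest and colours
  1, 2, 3 for the three independent sets. If every vertex of a set \<open>S\<close> has at most one
  neighbour outside \<open>S\<close>, then deleting \<open>S\<close> keeps all distances at most 2 between
  the remaining vertices, so a colouring of the rest can serve as the starting point. Suitable
  sets \<open>S\<close> show that every vertex has degree at least 2, that a path of two adjacent
  2-vertices ends in vertices of degree at least 5, that the exceptional neighbour of a 3-vertex
  with two 2-neighbours, or of a 5-vertex with four neighbours on such paths, has degree at least
  4, and that a vertex of degree at least 5 all of whose neighbours are of one of these kinds has
  at least three neighbours that are not on such paths.

  Now give each vertex \<open>v\<close> the charge \<open>3 deg v - 8\<close>. A vertex of degree at
  least 3 sends 2 to each neighbour on a path of two 2-vertices, and 1 to each other 2-neighbour,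
  to each 3-neighbour with two 2-neighbours and to each 5-neighbour with four neighbours on such
  paths. No final charge is negative, so the average degree is at least 8/3.
\<close>

section \<open>Colourings and cores\<close>

definition near :: "('a \<Rightarrow> 'a \<Rightarrow> bool) \<Rightarrow> 'a \<Rightarrow> 'a \<Rightarrow> bool" where
  "near E a b \<longleftrightarrow> E a b \<or> (\<exists>v. E a v \<and> E v b)"

text \<open>
  A set of vertices of a finite graph induces a forest iff it has no subset that is a core. This
  replaces reasoning about cycles by peeling off vertices with at most one remaining neighbour.
\<close>

definition core :: "('a \<Rightarrow> 'a \<Rightarrow> bool) \<Rightarrow> 'a set \<Rightarrow> bool" where
  "core E T \<longleftrightarrow> T \<noteq> {} \<and> (\<forall>v\<in>T. \<exists>a\<in>T. \<exists>b\<in>T. a \<noteq> b \<and> E v a \<and> E v b)"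

text \<open>The middle vertex of a path of length 2 ranges over \<open>V\<close>, so only adjacency
  inside \<open>V\<close> counts and one relation \<open>E\<close> serves for all subsets. Colour 0,
  the forest, is exempt from the distance condition.\<close>

definition good_colouring :: "('a \<Rightarrow> 'a \<Rightarrow> bool) \<Rightarrow> 'a set \<Rightarrow> ('a \<Rightarrow> nat) \<Rightarrow> bool" where
  "good_colouring E V c \<longleftrightarrow>
     (\<forall>v\<in>V. c v \<le> 3) \<and>
     (\<forall>a\<in>V. \<forall>b\<in>V. a \<noteq> b \<longrightarrow> c a \<noteq> 0 \<longrightarrow>
        (E a b \<or> (\<exists>v\<in>V. E a v \<and> E v b)) \<longrightarrow> c a \<noteq> c b) \<and>
     \<not> (\<exists>T\<subseteq>V. core E T \<and> (\<forall>v\<in>T. c v = 0))"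

lemma core_not_leaf:
  assumes "core E T" and "\<And>a. E v a \<Longrightarrow> a \<in> T \<Longrightarrow> a = z"
  shows "v \<notin> T"
  using assms unfolding core_def by metis

text \<open>Pigeonhole: \<open>j\<close> and at most two members of \<open>A\<close> supply three
  colours, so none of them is wasted on 0 or on a repetition. This describes the situation where no
  colour is free for a vertex.\<close>

lemma missing_colour:
  fixes c :: "'a \<Rightarrow> nat"
  assumes sub: "{1, 2, 3} \<subseteq> insert j (c ` A)" and A: "finite A" "card A \<le> 2"
  shows "j \<noteq> 0" and "\<And>a. a \<in> A \<Longrightarrow> c a \<noteq> 0 \<and> c a \<noteq> j"
proof -
  have "card (c ` A) \<le> 2"
    using card_image_le[OF A(1), of c] A(2) by linarith
  have fin: "finite (c ` A)"
    using A by blast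
  have card3: "card {1, 2, 3 :: nat} = 3"
    by simp
  have "3 \<le> card (insert j (c ` A))"
    using card_mono[OF _ sub] fin unfolding card3 by blast
  then have "card (insert j (c ` A)) = 3" and jn: "j \<notin> c ` A"
    using \<open>card (c ` A) \<le> 2\<close> fin by (auto simp: card_insert_if split: if_splits)
  then have "{1, 2, 3} = insert j (c ` A)"
    using card_subset_eq[OF _ sub] fin unfolding card3 by simp
  then show "j \<noteq> 0" and "\<And>a. a \<in> A \<Longrightarrow> c a \<noteq> 0 \<and> c a \<noteq> j"
    using jn by auto
qed

section \<open>Minimal counterexamples and deletable sets\<close>

locale minimal_counterexample =
  fixes V :: "'a set" and E :: "'a \<Rightarrow> 'a \<Rightarrow> bool"
  assumes fin: "finite V"
    and sym: "E a b \<Longrightarrow> E b a"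
    and irrefl: "\<not> E a a"
    and adj_V: "E a b \<Longrightarrow> a \<in> V"
    and minimal: "W \<subset> V \<Longrightarrow> \<exists>c. good_colouring E W c"
    and counterexample: "\<not> good_colouring E V c"
begin

definition N :: "'a \<Rightarrow> 'a set" where "N v = {w. E v w}"

definition deg :: "'a \<Rightarrow> nat" where "deg v = card (N v)"

lemma N_iff [simp]: "w \<in> N v \<longleftrightarrow> E v w"
  by (simp add: N_def)

lemma finite_N [simp]: "finite (N v)"
  by (rule finite_subset[OF _ fin]) (use adj_V sym in \<open>auto simp: N_def\<close>)

lemma finite_nbrs [simp]: "finite {w. E v w \<and> P w}"
  by (rule finite_subset[OF _ finite_N[of v]]) auto

lemma deg_2E:
  assumes "deg v = 2" "E v a"
  obtains b where "N v = {a, b}" "a \<noteq> b"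
  using assms unfolding deg_def card_2_iff N_def by (metis doubleton_eq_iff insertE mem_Collect_eq singletonD)

lemma deg_2_unique:
  assumes "deg v = 2" "E v a" "E v b" "E v d" "b \<noteq> a" "d \<noteq> a"
  shows "b = d"
proof -
  obtain z where "N v = {a, z}"
    using deg_2E[OF assms(1,2)] .
  then show ?thesis
    using assms N_iff by blast
qed

text \<open>A core containing a 2-vertex contains both its neighbours. Absence from a core therefore
  spreads along paths of 2-vertices.\<close>

lemma core_deg_2:
  assumes "core E T" "deg v = 2" "E v a" "a \<notin> T"
  shows "v \<notin> T"
  using assms deg_2_unique unfolding core_def by metis

text \<open>
  Vertices outside \<open>S\<close> may only lose their colour, which preserves the distance
  condition among them; the last condition says that every core of colour 0 is an old one.
\<close>

definition extends :: "'a set \<Rightarrow> ('a \<Rightarrow> nat) \<Rightarrow> ('a \<Rightarrow> nat) \<Rightarrow> bool" where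
  "extends S c c' \<longleftrightarrow>
     (\<forall>v. v \<notin> S \<longrightarrow> c' v = c v \<or> c' v = 0) \<and> (\<forall>v\<in>S. c' v \<le> 3) \<and>
     (\<forall>a\<in>S. \<forall>b. c' a \<noteq> 0 \<longrightarrow> b \<noteq> a \<longrightarrow> near E a b \<longrightarrow> c' b \<noteq> c' a) \<and>
     (\<forall>T. core E T \<longrightarrow> (\<forall>w\<in>T. c' w = 0) \<longrightarrow> (\<forall>v\<in>T. v \<notin> S \<and> c v = 0))"

lemma extendsI:
  assumes "\<And>v. v \<notin> S \<Longrightarrow> c' v = c v \<or> c' v = 0" and "\<And>v. v \<in> S \<Longrightarrow> c' v \<le> 3"
    and "\<And>a b. a \<in> S \<Longrightarrow> c' a \<noteq> 0 \<Longrightarrow> b \<noteq> a \<Longrightarrow> near E a b \<Longrightarrow> c' b \<noteq> c' a"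
    and "\<And>T v. core E T \<Longrightarrow> (\<And>w. w \<in> T \<Longrightarrow> c' w = 0) \<Longrightarrow> v \<in> T \<Longrightarrow> v \<notin> S \<and> c v = 0"
  shows "extends S c c'"
  using assms unfolding extends_def by blast

text \<open>By \<open>out\<close>, no vertex of \<open>S\<close> joins two different outer vertices,
  so outer vertices at distance at most 2 are so within \<open>V - S\<close> already. There
  minimality supplies a colouring, and an extension of it would be a good colouring of
  \<open>V\<close>.\<close>

lemma deletable:
  assumes S: "S \<subseteq> V" "S \<noteq> {}"
    and out: "\<And>s a b. s \<in> S \<Longrightarrow> E s a \<Longrightarrow> E s b \<Longrightarrow> a \<notin> S \<Longrightarrow> b \<notin> S \<Longrightarrow> a = b"
  shows "\<exists>c. (\<forall>v\<in>S. c v = 0) \<and> (\<forall>v. c v \<le> 3) \<and> (\<forall>c'. \<not> extends S c c')"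
proof -
  have "V - S \<subset> V"
    using S by blast
  then obtain c0 where good: "good_colouring E (V - S) c0"
    using minimal by blast
  \<comment> \<open>The default 0 puts \<open>S\<close> into the forest and makes the bound 3 hold
    everywhere.\<close>
  define c where "c v = (if v \<in> V - S then c0 v else 0)" for v
  have cS: "c v = 0" if "v \<in> S" for v
    using that by (simp add: c_def)
  have c3: "c v \<le> 3" for v
    using good by (simp add: c_def good_colouring_def)
  have "\<not> extends S c c'" for c'
  proof
    assume ext: "extends S c c'"
    then have c': "\<And>v. v \<notin> S \<Longrightarrow> c' v = c v \<or> c' v = 0" "\<And>v. v \<in> S \<Longrightarrow> c' v \<le> 3"
      and dist: "\<And>a b. a \<in> S \<Longrightarrow> c' a \<noteq> 0 \<Longrightarrow> b \<noteq> a \<Longrightarrow> near E a b \<Longrightarrow> c' b \<noteq> c' a"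
      and cores: "\<And>T. core E T \<Longrightarrow> \<forall>w\<in>T. c' w = 0 \<Longrightarrow> \<forall>v\<in>T. v \<notin> S \<and> c v = 0"
      unfolding extends_def by simp_all
    have "c' a \<noteq> c' b" if ab: "a \<in> V" "b \<in> V" "a \<noteq> b" "c' a \<noteq> 0" "near E a b" for a b
    proof (cases "a \<in> S \<or> b \<in> S")
      case True
      have "near E b a"
        using ab sym unfolding near_def by blast
      then show ?thesis
        using True dist[of a b] dist[of b a] ab by metis
    next
      case False
      show ?thesis
      proof
        assume eq: "c' a = c' b"
        \<comment> \<open>Outside \<open>S\<close> a colour is kept or becomes 0, so equal nonzero
          new colours are old ones.\<close>
        then have eq0: "c0 a = c0 b" "c0 a \<noteq> 0"
          using ab c' False unfolding c_def by (metis DiffI)+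
        consider "E a b" | v where "v \<in> S" "E a v" "E v b" | v where "v \<in> V - S" "E a v" "E v b"
          using ab adj_V unfolding near_def by blast
        then show False
        proof cases
          case 2
          then show False
            using out[of v a b] sym False ab by blast
        qed (use eq0 good ab False in \<open>unfold good_colouring_def, blast+\<close>)
      qed
    qed
    moreover have "\<not> core E T" if "T \<subseteq> V" "\<forall>v\<in>T. c' v = 0" for T
    proof
      assume core: "core E T"
      then have T: "v \<notin> S \<and> c v = 0" if "v \<in> T" for v
        using cores that \<open>\<forall>v\<in>T. c' v = 0\<close> by blast
      then have "T \<subseteq> V - S" "\<forall>v\<in>T. c0 v = 0"
        using \<open>T \<subseteq> V\<close> unfolding c_def by (blast, metis DiffI subsetD)
      then show False
        using good core unfolding good_colouring_def by blast
    qed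
    moreover have "c' v \<le> 3" for v
      using c' c3[of v] by (cases "v \<in> S") (auto, metis le0)
    ultimately have "good_colouring E V c'"
      unfolding good_colouring_def near_def by blast
    then show False
      using counterexample by blast
  qed
  then show ?thesis
    using cS c3 by blast
qed

section \<open>Excluded configurations\<close>

lemma deg_ge_2:
  assumes "v \<in> V"
  shows "2 \<le> deg v"
proof (rule ccontr)
  assume "\<not> 2 \<le> deg v"
  then have uniq: "a = b" if "E v a" "E v b" for a b
    using that card_le_Suc0_iff_eq[of "N v"] by (auto simp: deg_def)
  obtain c :: "'a \<Rightarrow> nat" where c: "\<And>w. w \<in> {v} \<Longrightarrow> c w = 0" and R: "\<And>c'. \<not> extends {v} c c'"
    using deletable[of "{v}"] assms uniq by blast
  \<comment> \<open>A vertex with at most one neighbour lies in no core, so \<open>v\<close> can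
    stay in the forest.\<close>
  have "extends {v} c c"
  proof (rule extendsI)
    fix T w assume T: "core E T" "\<And>z. z \<in> T \<Longrightarrow> c z = 0" "w \<in> T"
    have "v \<notin> T"
      using T(1) uniq unfolding core_def by metis
    then show "w \<notin> {v} \<and> c w = 0"
      using T by blast
  qed (use c in auto)
  then show False
    using R by blast
qed

definition thread :: "'a \<Rightarrow> bool" where
  "thread x \<longleftrightarrow> deg x = 2 \<and> (\<exists>y. E x y \<and> deg y = 2)"

text \<open>Delete \<open>x\<close> and \<open>y\<close>. If they cannot both join the forest, a
  core of colour 0 runs through them and both outer ends. Either some colour is absent from the
  other neighbours of \<open>u\<close> and \<open>x\<close> takes it, or these at most three
  neighbours use all three colours and \<open>u\<close> cannot lie in that core.\<close>

lemma thread_end_deg: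
  assumes "deg x = 2" "E x y" "deg y = 2" "E x u" "u \<noteq> y"
  shows "5 \<le> deg u"
proof (rule ccontr)
  assume "\<not> 5 \<le> deg u"
  obtain w where Ny: "N y = {x, w}"
    using deg_2E[OF assms(3) sym[OF assms(2)]] by blast
  have Nx: "E x a \<Longrightarrow> a = u \<or> a = y" for a
    using deg_2_unique[of x y a u] assms by blast
  have Ny': "E y a \<Longrightarrow> a = x \<or> a = w" for a
    using Ny N_iff by blast
  have E: "E y x" "E y w" "E u x" "x \<noteq> y" "u \<noteq> x"
    using Ny sym assms irrefl N_iff by blast+
  let ?S = "{x, y}"
  have SV: "?S \<subseteq> V" "?S \<noteq> {}"
    using E assms(2) adj_V by auto
  have out: "a = b" if "s \<in> ?S" "E s a" "E s b" "a \<notin> ?S" "b \<notin> ?S" for s a b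
    using that Nx Ny' by auto
  obtain c where c: "(\<forall>v\<in>?S. c v = 0) \<and> (\<forall>v. c v \<le> 3) \<and> (\<forall>c'. \<not> extends ?S c c')"
    by (rule exE[OF deletable[OF SV out]])
  then have c0: "\<And>v. v \<in> ?S \<Longrightarrow> c v = 0" and c3: "\<And>v. c v \<le> 3"
    and R: "\<And>c'. \<not> extends ?S c c'"
    by metis+
  have all0: "\<exists>T. core E T \<and> (\<forall>v\<in>T. c v = 0) \<and> x \<in> T \<and> y \<in> T \<and> u \<in> T \<and> w \<in> T"
  proof (rule ccontr)
    assume no: "\<not> ?thesis"
    have "extends ?S c c"
    proof (rule extendsI)
      fix T v assume T: "core E T" "\<And>z. z \<in> T \<Longrightarrow> c z = 0" "v \<in> T"
      then have "x \<notin> T \<or> y \<notin> T \<or> u \<notin> T \<or> w \<notin> T"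
        using no by blast
      then have "x \<notin> T \<and> y \<notin> T"
        using core_deg_2[OF T(1)] assms E by metis
      then show "v \<notin> ?S \<and> c v = 0"
        using T by blast
    qed (use c0 in auto)
    then show False
      using R by blast
  qed
  then have uw: "c u = 0" "c w = 0"
    by blast+
  show False
  proof (cases "{1, 2, 3} \<subseteq> c ` (N u - {x})")
    case True
    have "card (N u - {x}) \<le> 3"
      using \<open>\<not> 5 \<le> deg u\<close> E(3) by (simp add: deg_def)
    then have "card (c ` (N u - {x})) \<le> card {1, 2, 3 :: nat}"
      using card_image_le[of "N u - {x}" c] by simp
    then have "{1, 2, 3} = c ` (N u - {x})"
      using card_seteq[OF _ True] by simp
    then have nz: "c a \<noteq> 0" if "E u a" "a \<noteq> x" for a
      using that by auto
    obtain T where T: "core E T" "\<forall>v\<in>T. c v = 0" "u \<in> T"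
      using all0 by blast
    then have "u \<notin> T"
      using core_not_leaf[OF T(1), of u x] nz by blast
    then show False
      using T by blast
  next
    case False
    then obtain i where i: "i \<in> {1, 2, 3}" "i \<notin> c ` (N u - {x})"
      by blast
    have "extends ?S c (c(x := i))"
    proof (rule extendsI)
      fix a b assume ab: "a \<in> ?S" "(c(x := i)) a \<noteq> 0" "b \<noteq> a" "near E a b"
      then have [simp]: "a = x"
        using c0 by (auto split: if_splits)
      have "b = u \<or> b = y \<or> b = w \<or> E u b"
        using ab Nx Ny' unfolding near_def by auto
      then have "c b \<noteq> i"
        using i ab uw c0[of y] by auto
      then show "(c(x := i)) b \<noteq> (c(x := i)) a"
        using ab by simp
    next
      fix T v assume T: "core E T" "\<And>z. z \<in> T \<Longrightarrow> (c(x := i)) z = 0" "v \<in> T"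
      then have "x \<notin> T"
        using i T(2)[of x] by auto
      moreover then have "y \<notin> T"
        using core_deg_2[OF T(1)] assms E by metis
      ultimately show "v \<notin> ?S \<and> c v = 0"
        using T by (metis fun_upd_other insertE singletonD)
    qed (use c0 i in auto)
    then show False
      using R by blast
  qed
qed

text \<open>
  In the worst case, no colour is free for \<open>u\<close> and the other neighbours of \<open>t\<close>
  use the two colours different from that of \<open>t\<close>. Then \<open>t\<close> can join the
  forest as an isolated vertex and hand its colour to \<open>u\<close>.
\<close>

lemma three_vertex_two_2_nbrs:
  assumes N: "N u = {v1, v2, t}" and dist: "v1 \<noteq> v2" "t \<noteq> v1" "t \<noteq> v2"
    and deg: "deg v1 = 2" "deg v2 = 2"
  shows "4 \<le> deg t"
proof (rule ccontr)
  assume "\<not> 4 \<le> deg t"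
  have Nu: "E u a \<longleftrightarrow> a = v1 \<or> a = v2 \<or> a = t" for a
    using N N_iff by blast
  have E: "E v1 u" "E v2 u" "E t u"
    using Nu sym by blast+
  have ne: "u \<noteq> v1" "u \<noteq> v2" "u \<noteq> t"
    using Nu irrefl by blast+
  obtain w1 where "N v1 = {u, w1}" using deg_2E[OF deg(1) E(1)] by blast
  then have N1: "E v1 a \<longleftrightarrow> a = u \<or> a = w1" for a using N_iff by blast
  obtain w2 where "N v2 = {u, w2}" using deg_2E[OF deg(2) E(2)] by blast
  then have N2: "E v2 a \<longleftrightarrow> a = u \<or> a = w2" for a using N_iff by blast
  let ?A = "N t - {u}"
  have A: "finite ?A" "card ?A \<le> 2"
    using \<open>\<not> 4 \<le> deg t\<close> E(3) by (simp_all add: deg_def)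
  let ?S = "{u, v1, v2}"
  have SV: "?S \<subseteq> V" "?S \<noteq> {}"
    using E Nu adj_V by auto
  have out: "a = b" if "s \<in> ?S" "E s a" "E s b" "a \<notin> ?S" "b \<notin> ?S" for s a b
    using that Nu N1 N2 by auto
  obtain c where c: "(\<forall>v\<in>?S. c v = 0) \<and> (\<forall>v. c v \<le> 3) \<and> (\<forall>c'. \<not> extends ?S c c')"
    by (rule exE[OF deletable[OF SV out]])
  then have c0: "\<And>v. v \<in> ?S \<Longrightarrow> c v = 0" and c3: "\<And>v. c v \<le> 3"
    and R: "\<And>c'. \<not> extends ?S c c'"
    by metis+
  have near_u: "b = v1 \<or> b = v2 \<or> b = t \<or> b = w1 \<or> b = w2 \<or> b \<in> ?A" if "near E u b" "b \<noteq> u" for b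
    using that Nu N1 N2 unfolding near_def by auto
  \<comment> \<open>Otherwise a colour is free for \<open>u\<close>, and \<open>v1\<close> and
    \<open>v2\<close> then drop out of every core of colour 0.\<close>
  have step0: "{1, 2, 3} \<subseteq> {c w1, c w2, c t} \<union> c ` ?A"
  proof (rule ccontr)
    assume "\<not> ?thesis"
    then obtain i where i: "i \<in> {1, 2, 3}" "i \<notin> {c w1, c w2, c t}" "i \<notin> c ` ?A"
      by blast
    have "extends ?S c (c(u := i))"
    proof (rule extendsI)
      fix a b assume ab: "a \<in> ?S" "(c(u := i)) a \<noteq> 0" "b \<noteq> a" "near E a b"
      then have [simp]: "a = u"
        using c0 by (auto split: if_splits)
      have "c b \<noteq> i"
        using near_u[of b] ab i c0[of v1] c0[of v2] by auto
      then show "(c(u := i)) b \<noteq> (c(u := i)) a"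
        using ab by simp
    next
      fix T v assume T: "core E T" "\<And>z. z \<in> T \<Longrightarrow> (c(u := i)) z = 0" "v \<in> T"
      then have "u \<notin> T"
        using i T(2)[of u] by auto
      moreover then have "v1 \<notin> T" "v2 \<notin> T"
        using core_deg_2[OF T(1)] deg E by blast+
      ultimately show "v \<notin> ?S \<and> c v = 0"
        using T by (metis fun_upd_other insertE singletonD)
    qed (use c0 i in auto)
    then show False
      using R by blast
  qed
  have "\<not> extends ?S c c"
    using R by blast
  \<comment> \<open>The core that arises when \<open>u\<close>, \<open>v1\<close> and
    \<open>v2\<close> all stay in the forest.\<close>
  then have "\<exists>T. core E T \<and> (\<forall>v\<in>T. c v = 0) \<and> T \<inter> ?S \<noteq> {}"
    using c0 by (intro ccontr[of "\<exists>T. _ T"]) (erule notE, rule extendsI, auto)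
  then obtain T where T: "core E T" "\<forall>v\<in>T. c v = 0" "T \<inter> ?S \<noteq> {}"
    by blast
  have w1T: "v1 \<notin> T" if "c w1 \<noteq> 0"
    using core_deg_2[OF T(1) deg(1), of w1] N1 T(2) that by metis
  have w2T: "v2 \<notin> T" if "c w2 \<noteq> 0"
    using core_deg_2[OF T(1) deg(2), of w2] N2 T(2) that by metis
  have uT: "u \<in> T" using T(3) core_deg_2[OF T(1)] deg E by blast
  have two: "(v1 \<in> T \<and> v2 \<in> T) \<or> (v1 \<in> T \<and> t \<in> T) \<or> (v2 \<in> T \<and> t \<in> T)"
    using uT T(1) Nu unfolding core_def by metis
  have nbr_t: "\<exists>a\<in>?A. c a = 0" if "t \<in> T"
  proof (rule ccontr)
    assume "\<not> ?thesis"
    then have "t \<notin> T"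
      using T(2) by (intro core_not_leaf[OF T(1), of t u]) fastforce
    then show False
      using that by blast
  qed
  \<comment> \<open>A nonzero \<open>w1\<close> or \<open>w2\<close> cuts its branch off
    \<open>T\<close>, so \<open>T\<close> must use \<open>t\<close> and the other branch. Then
    \<open>c t\<close> and one of \<open>c w1\<close>, \<open>c w2\<close> are 0, and
    \<open>step0\<close> forces nonzero colours on all of \<open>?A\<close>, against
    \<open>nbr_t\<close>.\<close>
  have zero: "c w1 = 0 \<and> c w2 = 0"
  proof (rule ccontr)
    assume nz: "\<not> ?thesis"
    then have "t \<in> T" and "c w1 = 0 \<or> c w2 = 0"
      using two w1T w2T by blast+
    then have "{1, 2, 3} \<subseteq> insert (if c w1 = 0 then c w2 else c w1) (c ` ?A)"
      using step0 T(2) by auto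
    then show False
      using missing_colour[OF _ A] nbr_t[OF \<open>t \<in> T\<close>] by blast
  qed
  then have full: "{1, 2, 3} \<subseteq> insert (c t) (c ` ?A)"
    using step0 by auto
  note t = missing_colour[OF full A]
  let ?c = "c(t := 0, u := c t)"
  have "extends ?S c ?c"
  proof (rule extendsI)
    fix a b assume ab: "a \<in> ?S" "?c a \<noteq> 0" "b \<noteq> a" "near E a b"
    then have [simp]: "a = u"
      using c0 by (auto split: if_splits)
    show "?c b \<noteq> ?c a"
      using near_u[of b] ab t c0[of v1] c0[of v2] zero ne by auto
  next
    fix T v assume T: "core E T" "\<And>z. z \<in> T \<Longrightarrow> ?c z = 0" "v \<in> T"
    then have u: "u \<notin> T"
      using t(1) T(2)[of u] by auto
    have "t \<notin> T"
    proof (rule core_not_leaf[OF T(1)])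
      fix a assume "E t a" "a \<in> T"
      then have "a \<noteq> t" "a \<noteq> u" "?c a = 0"
        using irrefl u T(2) by blast+
      then show "a = u"
        using t(2)[of a] \<open>E t a\<close> by simp
    qed
    moreover have "v1 \<notin> T" "v2 \<notin> T"
      using core_deg_2[OF T(1)] deg E u by blast+
    ultimately show "v \<notin> ?S \<and> c v = 0"
      using u T by (metis fun_upd_other insertE singletonD)
  qed (use c0 c3 dist ne in auto)
  then show False
    using R by blast
qed

text \<open>Each thread at \<open>u\<close> is deleted together with its partner, so only
  \<open>t\<close> and the other neighbours of \<open>t\<close> can block a colour for
  \<open>u\<close>. If they block all three, \<open>t\<close> can again join the forest as an
  isolated vertex and hand its colour to \<open>u\<close>.\<close>

lemma almost_all_nbrs_threads:
  assumes ut: "E u t" "\<not> thread t" "deg u \<noteq> 2" and thr: "\<And>x. E u x \<Longrightarrow> x \<noteq> t \<Longrightarrow> thread x"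
  shows "4 \<le> deg t"
proof (rule ccontr)
  assume "\<not> 4 \<le> deg t"
  define X where "X = N u - {t}"
  \<comment> \<open>The thread partners of the vertices in \<open>X\<close>, whose other neighbour
    \<open>u\<close> is not a 2-vertex.\<close>
  define Y where "Y = {y. deg y = 2 \<and> (\<exists>x\<in>X. E y x)}"
  let ?S = "insert u (X \<union> Y)"
  let ?A = "N t - {u}"
  have A: "finite ?A" "card ?A \<le> 2"
    using \<open>\<not> 4 \<le> deg t\<close> sym[OF ut(1)] by (simp_all add: deg_def)
  have X: "E x u" "deg x = 2" if "x \<in> X" for x
    using that thr sym unfolding X_def thread_def by auto
  have XY: "a \<in> Y" if "x \<in> X" "E x a" "a \<noteq> u" for x a
  proof -
    obtain y where "E x y" "deg y = 2"
      using \<open>x \<in> X\<close> thr unfolding X_def thread_def by auto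
    then have "a = y"
      using deg_2_unique[of x u a y] X that ut by blast
    then show ?thesis
      using \<open>deg y = 2\<close> that sym unfolding Y_def by blast
  qed
  have "t \<notin> Y"
    using ut(2) X(2) unfolding Y_def thread_def by blast
  moreover have "t \<noteq> u"
    using ut irrefl by blast
  ultimately have tS: "t \<notin> ?S"
    by (simp add: X_def)
  have out: "a = b" if "s \<in> ?S" "E s a" "E s b" "a \<notin> ?S" "b \<notin> ?S" for s a b
  proof -
    consider "s = u" | "s \<in> X" | "s \<in> Y"
      using \<open>s \<in> ?S\<close> by blast
    then show ?thesis
    proof cases
      case 1
      then have "a = t" "b = t"
        using that unfolding X_def by auto
      then show ?thesis
        by simp
    next
      case 2
      then show ?thesis
        using XY that by blast
    next
      case 3
      then obtain x where "x \<in> X" "E s x" "deg s = 2"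
        unfolding Y_def by blast
      then show ?thesis
        using deg_2_unique[of s x a b] that by blast
    qed
  qed
  have SV: "?S \<subseteq> V" "?S \<noteq> {}"
    using adj_V[OF ut(1)] adj_V X(1) unfolding Y_def by blast+
  obtain c where c: "(\<forall>v\<in>?S. c v = 0) \<and> (\<forall>v. c v \<le> 3) \<and> (\<forall>c'. \<not> extends ?S c c')"
    by (rule exE[OF deletable[OF SV out]])
  then have c0: "\<And>v. v \<in> ?S \<Longrightarrow> c v = 0" and c3: "\<And>v. c v \<le> 3"
    and R: "\<And>c'. \<not> extends ?S c c'"
    by metis+
  have near_u: "b \<in> X \<union> Y \<or> b = t \<or> b \<in> ?A" if nb: "near E u b" "b \<noteq> u" for b
  proof -
    consider "E u b" | v where "E u v" "E v b"
      using nb unfolding near_def by blast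
    then show ?thesis
    proof cases
      case 2
      then show ?thesis
        using XY[of v b] that unfolding X_def by auto
    qed (auto simp: X_def)
  qed
  have peel: "T \<inter> ?S = {}" if "core E T" "u \<notin> T" for T
  proof -
    have "X \<inter> T = {}"
      using core_deg_2[OF that(1)] X that(2) by blast
    then have "Y \<inter> T = {}"
      using core_deg_2[OF that(1)] unfolding Y_def by blast
    then show ?thesis
      using \<open>X \<inter> T = {}\<close> that by blast
  qed
  have full: "{1, 2, 3} \<subseteq> insert (c t) (c ` ?A)"
  proof (rule ccontr)
    assume "\<not> ?thesis"
    then obtain i where i: "i \<in> {1, 2, 3}" "i \<noteq> c t" "i \<notin> c ` ?A"
      by blast
    have "extends ?S c (c(u := i))"
    proof (rule extendsI)
      fix a b assume ab: "a \<in> ?S" "(c(u := i)) a \<noteq> 0" "b \<noteq> a" "near E a b"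
      then have [simp]: "a = u"
        using c0 by (auto split: if_splits)
      have "c b \<noteq> i"
        using near_u[of b] ab i c0[of b] by auto
      then show "(c(u := i)) b \<noteq> (c(u := i)) a"
        using ab by simp
    next
      fix T v assume T: "core E T" "\<And>z. z \<in> T \<Longrightarrow> (c(u := i)) z = 0" "v \<in> T"
      then have "u \<notin> T"
        using i T(2)[of u] by auto
      then show "v \<notin> ?S \<and> c v = 0"
        using peel[OF T(1)] T by (metis disjoint_iff fun_upd_other)
    qed (use c0 i in auto)
    then show False
      using R by blast
  qed
  note t = missing_colour[OF full A]
  let ?c = "c(t := 0, u := c t)"
  have "extends ?S c ?c"
  proof (rule extendsI)
    fix a b assume ab: "a \<in> ?S" "?c a \<noteq> 0" "b \<noteq> a" "near E a b"
    then have [simp]: "a = u"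
      using c0 by (auto split: if_splits)
    show "?c b \<noteq> ?c a"
      using near_u[of b] ab t c0[of b] by auto
  next
    fix T v assume T: "core E T" "\<And>z. z \<in> T \<Longrightarrow> ?c z = 0" "v \<in> T"
    then have u: "u \<notin> T"
      using t(1) T(2)[of u] by auto
    have "t \<notin> T"
    proof (rule core_not_leaf[OF T(1)])
      fix a assume "E t a" "a \<in> T"
      then have "a \<noteq> t" "a \<noteq> u" "?c a = 0"
        using irrefl u T(2) by blast+
      then show "a = u"
        using t(2)[of a] \<open>E t a\<close> by simp
    qed
    then show "v \<notin> ?S \<and> c v = 0"
      using u T peel[OF T(1) u] by (metis disjoint_iff fun_upd_other)
  qed (use c0 c3 tS in auto)
  then show False
    using R by blast
qed

text \<open>Under the charge \<open>3 deg v - 8\<close>, a \<open>poor3\<close> vertex has 1 and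
  sends 2, and a \<open>poor5\<close> vertex has 7 and sends 8 along its threads. Each lacks exactly
  1, to be supplied by its remaining neighbour.\<close>

definition poor3 :: "'a \<Rightarrow> bool" where
  "poor3 v \<longleftrightarrow> deg v = 3 \<and> (\<exists>a b. E v a \<and> E v b \<and> a \<noteq> b \<and> deg a = 2 \<and> deg b = 2)"

definition poor5 :: "'a \<Rightarrow> bool" where
  "poor5 v \<longleftrightarrow> deg v = 5 \<and> card {x \<in> N v. thread x} = 4"

lemma poor3_N:
  assumes "poor3 v"
  obtains a b t where "N v = {a, b, t}" "a \<noteq> b" "t \<noteq> a" "t \<noteq> b" "deg a = 2" "deg b = 2"
proof -
  obtain a b where ab: "E v a" "E v b" "a \<noteq> b" "deg a = 2" "deg b = 2" and "deg v = 3"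
    using assms unfolding poor3_def by blast
  then have "card (N v - {a, b}) = 1"
    by (simp add: deg_def card_Diff_subset)
  then obtain t where "N v - {a, b} = {t}"
    by (rule card_1_singletonE)
  then have "N v = {a, b, t}" "t \<noteq> a" "t \<noteq> b"
    using ab N_iff by blast+
  then show thesis
    using that ab by blast
qed

lemma poor3_nbr_deg:
  assumes "poor3 v" "E v u" "deg u \<noteq> 2"
  shows "4 \<le> deg u"
proof -
  obtain a b t where t: "N v = {a, b, t}" "a \<noteq> b" "t \<noteq> a" "t \<noteq> b" "deg a = 2" "deg b = 2"
    using poor3_N[OF assms(1)] .
  then have "u = t"
    using assms N_iff[of u v] by auto
  then show ?thesis
    using three_vertex_two_2_nbrs t by blast
qed

lemma poor5_nbr_thread:
  assumes "poor5 v" "E v u" "\<not> thread u" "E v x" "x \<noteq> u"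
  shows "thread x"
proof (rule ccontr)
  assume "\<not> thread x"
  then have "{x \<in> N v. thread x} \<subseteq> N v - {u, x}"
    using assms by auto
  then have "card {x \<in> N v. thread x} \<le> card (N v - {u, x})"
    by (rule card_mono[rotated]) simp
  also have "\<dots> = 3"
    using assms by (simp add: card_Diff_subset deg_def poor5_def)
  finally show False
    using assms(1) by (simp add: poor5_def)
qed

lemma poor5_nbr_deg:
  assumes "poor5 v" "E v u" "\<not> thread u"
  shows "4 \<le> deg u"
  using almost_all_nbrs_threads[OF assms(2,3)] poor5_nbr_thread[OF assms] assms(1)
  unfolding poor5_def by simp

text \<open>
  With at most two neighbours outside threads, three colours suffice to colour \<open>u\<close> and
  those of the two that would otherwise connect several branches of the forest.
\<close>

lemma many_demanding_nbrs:
  assumes u: "u \<in> V" "5 \<le> deg u"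
    and nbrs: "\<And>p. E u p \<Longrightarrow> thread p \<or> deg p = 2 \<or> poor3 p \<or> poor5 p"
  shows "3 \<le> card {p \<in> N u. \<not> thread p}"
proof (rule ccontr)
  let ?O = "{p \<in> N u. \<not> thread p}"
  assume "\<not> 3 \<le> card ?O"
  then have cardO: "card ?O \<le> 2"
    by simp
  have finO: "finite ?O"
    by simp
  have u_nt: "\<not> thread u"
    using u by (simp add: thread_def)
  define X where "X = {v. deg v = 2 \<and> (\<exists>p. E u p \<and> E v p)}"
  define Y where "Y = {y. deg y = 2 \<and> (\<exists>x\<in>X. E y x)}"
  \<comment> \<open>Two layers beyond the neighbours of \<open>u\<close>: \<open>X\<close> reaches
    the thread partners and the 2-neighbours of poor vertices, \<open>Y\<close> the partners of the
    threads at \<open>poor5\<close> neighbours.\<close>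
  define S where "S = insert u (N u \<union> X \<union> Y)"
  have NuV: "E p u" if "E u p" for p
    using that sym by blast
  have S: "u \<in> S" "\<And>p. E u p \<Longrightarrow> p \<in> S" "\<And>x. x \<in> X \<Longrightarrow> x \<in> S" "\<And>y. y \<in> Y \<Longrightarrow> y \<in> S"
    unfolding S_def by simp_all
  have XI: "v \<in> X" if "E u p" "E p v" "deg v = 2" for p v
    using that sym unfolding X_def by blast
  have YI: "v \<in> Y" if "x \<in> X" "E x v" "deg v = 2" for x v
    using that sym unfolding Y_def by blast
  have nbr2: "a \<in> S" if "E u p" "E p a" "deg p \<noteq> 2 \<or> thread p" for p a
  proof (cases "a = u")
    case False
    have "deg a = 2" if p: "thread p"
    proof -
      obtain y where "E p y" "deg y = 2" "deg p = 2"
        using p unfolding thread_def by blast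
      moreover have "y \<noteq> u"
        using u \<open>deg y = 2\<close> by auto
      ultimately show ?thesis
        using deg_2_unique[of p u a y] NuV \<open>E u p\<close> \<open>E p a\<close> False by blast
    qed
    moreover have "deg a = 2" if p: "poor3 p"
    proof -
      obtain b d t where t: "N p = {b, d, t}" "deg b = 2" "deg d = 2"
        using poor3_N[OF p] .
      moreover have "u \<in> N p" "a \<in> N p"
        using \<open>E u p\<close> \<open>E p a\<close> sym by auto
      ultimately show ?thesis
        using u False by auto
    qed
    moreover have "deg a = 2" if "poor5 p"
      using poor5_nbr_thread[OF that NuV[OF \<open>E u p\<close>] u_nt \<open>E p a\<close> False] by (simp add: thread_def)
    ultimately show ?thesis
      using nbrs[OF \<open>E u p\<close>] that XI[OF that(1,2)] S by blast
  qed (simp add: S)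
  have SV: "S \<subseteq> V" "S \<noteq> {}"
    using u sym adj_V unfolding S_def X_def Y_def N_def by blast+
  have out: "a = b" if s: "s \<in> S" "E s a" "E s b" "a \<notin> S" "b \<notin> S" for s a b
  proof -
    consider "s = u" | "E u s" | "s \<in> X" | "s \<in> Y"
      using \<open>s \<in> S\<close> unfolding S_def by auto
    then show ?thesis
    proof cases
      case 1
      then show ?thesis
        using s S by blast
    next
      case 2
      then have "deg s = 2"
        using nbr2[of s a] s by blast
      then show ?thesis
        using deg_2_unique[of s u a b] NuV[OF 2] s S by blast
    next
      case 3
      then obtain p where "E s p" "p \<in> S" "deg s = 2"
        using S unfolding X_def by blast
      then show ?thesis
        using deg_2_unique[of s p a b] s by blast
    next
      case 4
      then obtain p where "E s p" "p \<in> S" "deg s = 2"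
        using S unfolding Y_def by blast
      then show ?thesis
        using deg_2_unique[of s p a b] s by blast
    qed
  qed
  obtain c where c: "(\<forall>v\<in>S. c v = 0) \<and> (\<forall>v. c v \<le> 3) \<and> (\<forall>c'. \<not> extends S c c')"
    by (rule exE[OF deletable[OF SV out]])
  then have c0: "\<And>v. v \<in> S \<Longrightarrow> c v = 0" and c3: "\<And>v. c v \<le> 3"
    and R: "\<And>c'. \<not> extends S c c'"
    by metis+
  have "\<exists>k. \<forall>w. E p w \<longrightarrow> w \<noteq> u \<longrightarrow> c w = k" if p: "E u p" "deg p = 2" for p
  proof -
    obtain w where "N p = {u, w}"
      using deg_2E[OF p(2) NuV[OF p(1)]] .
    then have "\<forall>w'. E p w' \<longrightarrow> w' \<noteq> u \<longrightarrow> c w' = c w"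
      using N_iff by blast
    then show ?thesis ..
  qed
  then obtain f where f: "\<And>p w. E u p \<Longrightarrow> deg p = 2 \<Longrightarrow> E p w \<Longrightarrow> w \<noteq> u \<Longrightarrow> c w = f p"
    by metis
  \<comment> \<open>For a 2-neighbour \<open>p\<close>, \<open>f p\<close> is the colour beyond
    \<open>p\<close>; for other \<open>p\<close> it is arbitrary. Since \<open>?O\<close> has at
    most two members, some colour \<open>i\<close> avoids all these values and goes to
    \<open>u\<close>.\<close>
  have "card (f ` ?O) < card {1, 2, 3 :: nat}"
    using card_image_le[OF finO, of f] cardO by simp
  then have "\<not> {1, 2, 3} \<subseteq> f ` ?O"
    using card_mono[of "f ` ?O" "{1, 2, 3}"] finO by fastforce
  then obtain i where i: "i \<in> {1, 2, 3}" "i \<notin> f ` ?O"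
    by blast
  \<comment> \<open>The other two colours are reserved for the members of \<open>?O\<close>, one
    each.\<close>
  have "card ({1, 2, 3} - {i}) = 2"
    using i(1) by auto
  then obtain h where h: "h ` ?O \<subseteq> {1, 2, 3} - {i}" "inj_on h ?O"
    using card_le_inj[of ?O "{1, 2, 3} - {i}"] cardO finO by auto
  \<comment> \<open>The neighbours of \<open>u\<close> to be coloured. They meet no nonzero old
    colour within distance 2, whereas any other \<open>poor3\<close> neighbour has a nonzero vertex
    beyond one of its branches, which cuts that branch off every core of colour 0.\<close>
  define M where
    "M = {p \<in> N u. poor5 p \<or> poor3 p \<and> (\<forall>v w. E p v \<longrightarrow> v \<noteq> u \<longrightarrow> E v w \<longrightarrow> c w = 0)}"
  define c' where "c' v = (if v = u then i else if v \<in> M then h v else c v)" for v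
  have deg_M: "deg p \<noteq> 2" "E u p" if "p \<in> M" for p
    using that unfolding M_def poor3_def poor5_def by auto
  have M_O: "M \<subseteq> ?O"
    using deg_M by (auto simp: thread_def)
  have uM: "u \<notin> M"
    using deg_M irrefl by blast
  have hM: "h p \<in> {1, 2, 3}" "h p \<noteq> i" if "p \<in> M" for p
    using h(1) M_O that by blast+
  have c'_out: "c' v = c v" if "v \<notin> S" for v
    using that S deg_M by (auto simp: c'_def)
  have "extends S c c'"
  proof (rule extendsI)
    show "c' v = c v \<or> c' v = 0" if "v \<notin> S" for v
      using c'_out that by blast
    show "c' v \<le> 3" if "v \<in> S" for v
      using i(1) hM[of v] c0[OF that] by (auto simp: c'_def)
  next
    fix a b assume ab: "a \<in> S" "c' a \<noteq> 0" "b \<noteq> a" "near E a b"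
    have b0: "c' b = 0" if "b \<noteq> u" "b \<notin> M" "b \<in> S"
      using that c0 by (simp add: c'_def)
    have a: "a = u \<or> a \<in> M"
      using ab(1,2) c0 by (auto simp: c'_def split: if_splits)
    show "c' b \<noteq> c' a"
    proof (cases "b = u \<or> b \<in> M")
      case True
      have "c' u = i" and "\<And>p. p \<in> M \<Longrightarrow> c' p = h p"
        using uM by (auto simp: c'_def)
      moreover have "h a \<noteq> h b" if "a \<in> M" "b \<in> M"
      proof -
        have "a \<in> ?O" "b \<in> ?O"
          using that M_O by blast+
        then show ?thesis
          using inj_on_eq_iff[OF h(2)] ab(3) by metis
      qed
      ultimately show ?thesis
        using a True ab(3) hM by metis
    next
      case bM: False
      show ?thesis
      proof (cases "b \<in> S")
        case True
        then show ?thesis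
          using b0 bM ab(2) by simp
      next
        case False
        then have cb: "c' b = c b"
          by (rule c'_out)
        show ?thesis
        proof (cases "a = u")
          case True
          \<comment> \<open>A vertex outside \<open>S\<close> is reached from \<open>u\<close> only
            through a 2-neighbour \<open>p\<close> off the threads, and \<open>i\<close> avoids
            \<open>f p\<close>.\<close>
          then obtain p where p: "E u p" "E p b"
            using ab(4) S(2) False unfolding near_def by blast
          then have "deg p = 2" "\<not> thread p"
            using nbr2 False by blast+
          then have "c b = f p" "p \<in> ?O"
            using f p bM by auto
          then have "c b \<noteq> i"
            using i(2) by auto
          then show ?thesis
            using cb True by (simp add: c'_def)
        next
          case False
          then have aM: "a \<in> M"
            using a by blast
          then have "\<not> E a b"
            using nbr2 deg_M \<open>b \<notin> S\<close> by blast
          then obtain v where v: "E a v" "E v b"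
            using ab(4) unfolding near_def by blast
          have "v \<noteq> u"
            using v S(2) \<open>b \<notin> S\<close> by blast
          \<comment> \<open>In the \<open>poor5\<close> case \<open>b\<close> would be a thread
            partner in \<open>Y\<close>, hence in \<open>S\<close>.\<close>
          have "c b = 0"
          proof (cases "poor5 a")
            case True
            then have "thread v"
              using poor5_nbr_thread[of a u v] v \<open>v \<noteq> u\<close> u_nt NuV deg_M(2)[OF aM] by blast
            then obtain y where y: "E v y" "deg y = 2" "deg v = 2"
              unfolding thread_def by blast
            have "y \<noteq> a" "b \<noteq> a"
              using deg_M(1)[OF aM] y ab by auto
            then have "b = y"
              using deg_2_unique[of v a b y] y v sym by blast
            then have "b \<in> S"
              using YI[OF XI[OF deg_M(2)[OF aM] v(1)]] y S by blast
            then show ?thesis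
              using \<open>b \<notin> S\<close> by blast
          next
            case False
            then show ?thesis
              using aM v \<open>v \<noteq> u\<close> unfolding M_def by blast
          qed
          then show ?thesis
            using cb ab(2) by simp
        qed
      qed
    qed
  next
    fix T v assume T: "core E T" "\<And>z. z \<in> T \<Longrightarrow> c' z = 0" "v \<in> T"
    have uT: "u \<notin> T"
      using T(2)[of u] i(1) by (auto simp: c'_def)
    have MT: "p \<notin> T" if "p \<in> M" for p
    proof
      assume "p \<in> T"
      moreover have "c' p = h p"
        using that uM by (auto simp: c'_def)
      ultimately show False
        using T(2)[of p] hM(1)[OF that] by auto
    qed
    have pT: "p \<notin> T" if p: "E u p" for p
    proof (cases "deg p = 2 \<or> p \<in> M")
      case True
      then show ?thesis
        using core_deg_2[OF T(1) _ NuV[OF p] uT] MT by blast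
    next
      case False
      then have "poor3 p"
        using nbrs[OF p] p unfolding thread_def M_def by auto
      \<comment> \<open>Exclusion from \<open>M\<close> yields a nonzero \<open>w\<close> beyond
        \<open>x\<close>. Then \<open>w\<close>, \<open>x\<close> and \<open>u\<close> are outside
        \<open>T\<close>, and \<open>p\<close> has at most one neighbour left.\<close>
      then obtain x w where xw: "E p x" "x \<noteq> u" "E x w" "c w \<noteq> 0"
        using False p unfolding M_def by auto
      have "w \<notin> T"
        using T(2)[of w] xw(4) hM[of w] i(1) by (auto simp: c'_def split: if_splits)
      obtain b d t where N: "N p = {b, d, t}" "deg b = 2" "deg d = 2"
        using poor3_N[OF \<open>poor3 p\<close>] .
      then have Np: "y \<in> {b, d, t}" if "E p y" for y
        using that N_iff by blast
      have "u = t"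
        using Np[OF NuV[OF p]] N u by auto
      then have "x = b \<or> x = d"
        using Np[OF xw(1)] xw(2) by auto
      then have "deg x = 2" "\<exists>z. \<forall>y. E p y \<longrightarrow> y = u \<or> y = x \<or> y = z"
        using N Np \<open>u = t\<close> by blast+
      have "x \<notin> T"
        using core_deg_2[OF T(1) \<open>deg x = 2\<close> xw(3) \<open>w \<notin> T\<close>] .
      obtain z where "\<forall>y. E p y \<longrightarrow> y = u \<or> y = x \<or> y = z"
        using \<open>\<exists>z. _ z\<close> by blast
      then show ?thesis
        using core_not_leaf[OF T(1), of p z] \<open>x \<notin> T\<close> uT by blast
    qed
    have XT: "x \<notin> T" if "x \<in> X" for x
      using that core_deg_2[OF T(1)] pT unfolding X_def by blast
    have YT: "y \<notin> T" if "y \<in> Y" for y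
      using that core_deg_2[OF T(1)] XT unfolding Y_def by blast
    have vS: "v \<notin> S"
      using \<open>v \<in> T\<close> uT pT XT YT unfolding S_def by auto
    moreover have "c v = 0"
      using T(2)[OF \<open>v \<in> T\<close>] c'_out[OF vS] by simp
    ultimately show "v \<notin> S \<and> c v = 0" ..
  qed
  then show False
    using R by blast
qed

section \<open>Discharging\<close>

definition gives :: "'a \<Rightarrow> 'a \<Rightarrow> int" where
  "gives u p = (if deg u \<le> 2 then 0 else if thread p then 2
     else if deg p = 2 \<or> poor3 p \<or> poor5 p then 1 else 0)"

lemma gives_nonneg: "0 \<le> gives u p"
  by (simp add: gives_def)

text \<open>A 2-vertex lacks 2: a thread vertex gets it from its single giving neighbour, any other
  2-vertex gets 1 from each side. Vertices of degree 3 or 4 have no thread neighbours. From degree 5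
  on, the amount sent exceeds the charge only if almost all neighbours demand, and the excluded
  configurations settle these cases.\<close>

lemma final_charge:
  assumes v: "v \<in> V"
  shows "8 + (\<Sum>p\<in>N v. gives v p) \<le> 3 * int (deg v) + (\<Sum>p\<in>N v. gives p v)"
proof -
  define K where "K = {p \<in> N v. thread p}"
  define M where "M = {p \<in> N v. \<not> thread p \<and> (deg p = 2 \<or> poor3 p \<or> poor5 p)}"
  have KM: "finite K" "finite M" "K \<inter> M = {}" "K \<union> M \<subseteq> N v"
    unfolding K_def M_def by auto
  have gets: "gives p v \<le> (\<Sum>p\<in>N v. gives p v)" if "E v p" for p
    by (rule member_le_sum) (use that gives_nonneg in auto)
  have gets0: "0 \<le> (\<Sum>p\<in>N v. gives p v)"
    by (rule sum_nonneg) (rule gives_nonneg)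
  have card_KM: "card K + card M \<le> deg v"
    using card_mono[OF finite_N KM(4)] card_Un_disjoint[OF KM(1-3)] by (simp add: deg_def)
  have gave: "(\<Sum>p\<in>N v. gives v p) = 2 * int (card K) + int (card M)" if "3 \<le> deg v"
  proof -
    have "(\<Sum>p\<in>N v. gives v p) = (\<Sum>p\<in>N v. (if p \<in> K then 2 else 0) + (if p \<in> M then 1 else 0))"
      by (rule sum.cong) (use that in \<open>auto simp: gives_def K_def M_def\<close>)
    also have "\<dots> = (\<Sum>p\<in>K. 2) + (\<Sum>p\<in>M. 1)"
      using KM by (simp add: sum.distrib sum.If_cases Int_absorb1)
    finally show ?thesis
      by simp
  qed
  have K0: "K = {}" if "3 \<le> deg v" "deg v < 5"
  proof -
    have "5 \<le> deg v" if "E v x" "thread x" for x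
      using that thread_end_deg[of x _ v] sym \<open>3 \<le> deg v\<close> unfolding thread_def by fastforce
    then show ?thesis
      using that unfolding K_def by auto
  qed
  consider "deg v = 2" | "deg v = 3" | "deg v = 4" | "5 \<le> deg v"
    using deg_ge_2[OF v] by linarith
  then show ?thesis
  proof cases
    case 1
    obtain a b where ab: "N v = {a, b}" "a \<noteq> b"
      using 1 unfolding deg_def card_2_iff by blast
    then have E: "E v a" "E v b"
      using N_iff by blast+
    have "2 \<le> gives a v + gives b v"
    proof (cases "thread v")
      case True
      then obtain y where "y \<in> N v" "deg y = 2"
        unfolding thread_def by auto
      then have "deg a = 2 \<or> deg b = 2"
        using ab(1) by auto
      then have "5 \<le> deg b \<or> 5 \<le> deg a"
        using thread_end_deg[OF 1] E ab(2) by metis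
      then show ?thesis
        using True gives_nonneg[of a v] gives_nonneg[of b v] by (auto simp: gives_def)
    next
      case False
      then have "deg a \<noteq> 2" "deg b \<noteq> 2"
        using E 1 unfolding thread_def by blast+
      then have "3 \<le> deg a" "3 \<le> deg b"
        using deg_ge_2 adj_V sym E by (metis le_neq_implies_less less_eq_Suc_le numeral_3_eq_3 numeral_2_eq_2)+
      then show ?thesis
        using False 1 by (simp add: gives_def)
    qed
    moreover have "(\<Sum>p\<in>N v. gives v p) = 0"
      using 1 by (simp add: gives_def)
    ultimately show ?thesis
      using ab 1 by simp
  next
    case 2
    \<comment> \<open>A \<open>poor3\<close> or \<open>poor5\<close> neighbour would force degree at
      least 4 on \<open>v\<close>.\<close>
    have M2: "deg p = 2" if "p \<in> M" for p
      using that poor3_nbr_deg[of p v] poor5_nbr_deg[of p v] sym 2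
      unfolding M_def thread_def by auto
    show ?thesis
    proof (cases "card M \<le> 1")
      case True
      then show ?thesis
        using gave K0 2 gets0 by simp
    next
      case False
      then obtain a b where ab: "a \<in> M" "b \<in> M" "a \<noteq> b"
        using card_le_Suc0_iff_eq[OF KM(2)] by auto
      have "E v a" "E v b"
        using ab unfolding M_def by simp_all
      then have "poor3 v"
        using 2 M2 ab unfolding poor3_def by blast
      then obtain d e t where t: "N v = {d, e, t}" "d \<noteq> e" "t \<noteq> d" "t \<noteq> e" "deg d = 2" "deg e = 2"
        by (rule poor3_N)
      then have dt: "4 \<le> deg t"
        using three_vertex_two_2_nbrs by blast
      then have "M \<subseteq> {d, e}"
        using M2[of t] KM(4) t(1) by auto
      then have "card M \<le> 2"
        using card_mono[of "{d, e}" M] t(2) by simp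
      moreover have "gives t v = 1"
        using dt \<open>poor3 v\<close> 2 by (simp add: gives_def thread_def)
      moreover have "E v t"
        using t(1) N_iff by blast
      ultimately show ?thesis
        using gave K0 2 gets[of t] by simp
    qed
  next
    case 3
    then show ?thesis
      using gave K0 card_KM gets0 by simp
  next
    case 4
    note g = gave[OF order_trans[OF _ 4]]
    \<comment> \<open>If every neighbour demands, at least three demand only 1, and
      \<open>2 deg v - 3\<close> is at most \<open>3 deg v - 8\<close>. Otherwise at most
      \<open>2 deg v - 2\<close> is sent, which is too much only for degree 5 with four
      threads.\<close>
    show ?thesis
    proof (cases "card K + card M = deg v")
      case True
      then have "K \<union> M = N v"
        using card_subset_eq[OF finite_N KM(4)] card_Un_disjoint[OF KM(1-3)] by (simp add: deg_def)
      then have "M = {p \<in> N v. \<not> thread p}" and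
        "\<And>p. E v p \<Longrightarrow> thread p \<or> deg p = 2 \<or> poor3 p \<or> poor5 p"
        using N_iff[of _ v] unfolding K_def M_def by blast+
      then have "3 \<le> card M"
        using many_demanding_nbrs[OF v 4] by simp
      then show ?thesis
        using g True 4 gets0 by simp
    next
      case False
      show ?thesis
      proof (cases "deg v = 5 \<and> card K = 4")
        case True
        then have "poor5 v"
          by (simp add: poor5_def K_def)
        have "card (N v - K) = 1"
          using True KM by (simp add: card_Diff_subset deg_def)
        then obtain t where "N v - K = {t}"
          by (rule card_1_singletonE)
        then have t: "E v t" "\<not> thread t"
          unfolding K_def by auto
        have "gives t v = 1"
          using poor5_nbr_deg[OF \<open>poor5 v\<close> t] \<open>poor5 v\<close> 4 by (simp add: gives_def thread_def)
        then show ?thesis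
          using g True False card_KM gets[OF t(1)] by simp
      next
        case no: False
        then show ?thesis
          using g False card_KM 4 gets0 by linarith
      qed
    qed
  qed
qed

text \<open>Everything sent is received, so the transfers cancel when the final charges are
  summed.\<close>

lemma average_degree_ge: "8 * int (card V) \<le> 3 * int (\<Sum>v\<in>V. deg v)"
proof -
  have N: "N v = {p \<in> V. E v p}" for v
    using adj_V sym unfolding N_def by blast
  have "(\<Sum>v\<in>V. \<Sum>p\<in>N v. gives v p) = (\<Sum>v\<in>V. \<Sum>p\<in>{p \<in> V. E p v}. gives p v)"
    unfolding N by (rule sum.swap_restrict[OF fin fin])
  also have "\<dots> = (\<Sum>v\<in>V. \<Sum>p\<in>N v. gives p v)"
    using sym unfolding N by (intro sum.cong) auto
  finally have "(\<Sum>v\<in>V. \<Sum>p\<in>N v. gives v p) = (\<Sum>v\<in>V. \<Sum>p\<in>N v. gives p v)" .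
  moreover have "(\<Sum>v\<in>V. 8 + (\<Sum>p\<in>N v. gives v p)) \<le> (\<Sum>v\<in>V. 3 * int (deg v) + (\<Sum>p\<in>N v. gives p v))"
    by (rule sum_mono) (rule final_charge)
  ultimately show ?thesis
    by (simp add: sum.distrib sum_distrib_left)
qed

end

section \<open>From sparsity to a good colouring\<close>

lemma good_colouring_cong:
  assumes "\<And>a b. a \<in> V \<Longrightarrow> b \<in> V \<Longrightarrow> E a b \<longleftrightarrow> E' a b"
  shows "good_colouring E V c \<longleftrightarrow> good_colouring E' V c"
proof -
  have "core E T \<longleftrightarrow> core E' T" if "T \<subseteq> V" for T
    unfolding core_def using that assms by (metis subsetD)
  then show ?thesis
    unfolding good_colouring_def using assms by (intro conj_cong refl) blast+
qed

text \<open>A smallest subset without a good colouring is a minimal counterexample, so its average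
  degree of at least 8/3 contradicts \<open>sparse\<close>.\<close>

lemma sparse_good_colouring:
  assumes fin: "finite V" and sym: "\<And>a b. E a b \<Longrightarrow> E b a" and irrefl: "\<And>a. \<not> E a a"
    and sparse: "\<And>W. W \<subseteq> V \<Longrightarrow> W \<noteq> {} \<Longrightarrow>
      3 * (\<Sum>v\<in>W. card {w \<in> W. E v w}) < 8 * card W"
  shows "\<exists>c. good_colouring E V c"
proof -
  have "W \<subseteq> V \<longrightarrow> (\<exists>c. good_colouring E W c)" if "finite W" for W
    using that
  proof (induction W rule: finite_psubset_induct)
    case (psubset W)
    \<comment> \<open>The locale wants adjacent vertices to lie in its vertex set; on subsets of
      \<open>W\<close>, \<open>good_colouring\<close> does not see the restriction.\<close>
    let ?E = "\<lambda>a b. a \<in> W \<and> b \<in> W \<and> E a b"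
    have cong: "good_colouring ?E U c \<longleftrightarrow> good_colouring E U c" if "U \<subseteq> W" for U c
      by (rule good_colouring_cong) (use that in blast)
    show ?case
    proof (rule impI, rule ccontr)
      assume W: "W \<subseteq> V" and none: "\<nexists>c. good_colouring E W c"
      interpret minimal_counterexample W ?E
      proof
        show "\<exists>c. good_colouring ?E U c" if "U \<subset> W" for U
          using psubset.IH[OF that] that W cong by blast
        show "\<not> good_colouring ?E W c" for c
          using none cong by blast
      qed (use psubset.hyps sym irrefl in blast)+
      have "W \<noteq> {}"
        using none by (auto simp: good_colouring_def core_def)
      then have "3 * (\<Sum>v\<in>W. card {w \<in> W. E v w}) < 8 * card W"
        by (rule sparse[OF W])
      moreover have "(\<Sum>v\<in>W. deg v) = (\<Sum>v\<in>W. card {w \<in> W. E v w})"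
        by (rule sum.cong) (simp_all add: deg_def N_def)
      ultimately show False
        using average_degree_ge by linarith
    qed
  qed
  then show ?thesis
    using fin by blast
qed

section \<open>Edges and maximum average degree\<close>

lemma sum_degrees_eq_edges:
  assumes "graph H"
  shows "(\<Sum>v\<in>verts H. card {w \<in> verts H. v \<rightarrow>\<^bsub>H\<^esub> w}) = 2 * card (edges H)"
proof -
  interpret graph H by fact
  let ?P = "arcs_ends H"
  let ?g = "\<lambda>(u, v). {u, v}"
  have P: "?P = (SIGMA v : verts H. {w \<in> verts H. v \<rightarrow>\<^bsub>H\<^esub> w})"
    by (auto dest: adj_in_verts)
  have finP: "finite ?P"
    by (simp add: arcs_ends_def)
  have edges: "edges H = ?g ` ?P"
    by (simp add: edges_def arcs_ends_def arc_to_ends_def image_image)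
  have "(\<Sum>v\<in>verts H. card {w \<in> verts H. v \<rightarrow>\<^bsub>H\<^esub> w}) =
      card (SIGMA v : verts H. {w \<in> verts H. v \<rightarrow>\<^bsub>H\<^esub> w})"
    by (rule card_SigmaI[symmetric]) auto
  also have "\<dots> = card ?P"
    by (rule arg_cong[OF P[symmetric]])
  also have "\<dots> = (\<Sum>q\<in>?P. 1)"
    by simp
  \<comment> \<open>Ordered pairs are grouped by undirected edge; each fibre consists of the two
    orientations.\<close>
  also have "\<dots> = (\<Sum>e\<in>?g ` ?P. \<Sum>q\<in>{q \<in> ?P. ?g q = e}. 1)"
    by (rule sum.image_gen[OF finP])
  also have "\<dots> = (\<Sum>e\<in>?g ` ?P. 2)"
  proof (rule sum.cong[OF refl])
    fix e assume "e \<in> ?g ` ?P"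
    then obtain u v where uv: "(u, v) \<in> ?P" "e = {u, v}"
      by auto
    then have "(v, u) \<in> ?P"
      using graph_symmetric by blast
    then have "{q \<in> ?P. ?g q = e} = {(u, v), (v, u)}"
      using uv by (fastforce simp: doubleton_eq_iff)
    moreover have "u \<noteq> v"
      using uv(1) adj_not_same by blast
    ultimately show "(\<Sum>q\<in>{q \<in> ?P. ?g q = e}. 1) = (2 :: nat)"
      by simp
  qed
  finally show ?thesis
    using edges by simp
qed

text \<open>The bound on \<open>mad\<close> is applied to the subgraph induced by \<open>W\<close>,
  where adjacency is that of \<open>G\<close>.\<close>

lemma induced_degrees_less:
  assumes "graph G" "mad G < 8 / 3" "W \<subseteq> verts G" "W \<noteq> {}"
  shows "3 * (\<Sum>v\<in>W. card {w \<in> W. v \<rightarrow>\<^bsub>G\<^esub> w}) < 8 * card W"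
proof -
  interpret graph G by fact
  let ?H = "G \<restriction> W"
  let ?M = "{2 * real (card (edges H)) / real (card (verts H)) | H.
    graph H \<and> subgraph H G \<and> verts H \<noteq> {}}"
  have ind: "induced_subgraph ?H G"
    using assms(3) by blast
  have H: "graph ?H"
    using digraphI_induced[OF ind] induced_graph_imp_graph[OF ind]
    by (simp add: graph_def pseudo_graph_def digraph_def)
  have "2 * real (card (edges ?H)) / real (card W) \<in> ?M"
    using H induced_imp_subgraph[OF ind] assms(4) by force
  then have "2 * real (card (edges ?H)) / real (card W) \<le> Max ?M"
    by (rule Max_ge[OF mad_set(1)[OF assms(1)]])
  also have "Max ?M < 8 / 3"
    using assms(2-4) by (auto simp: mad_def split: if_splits)
  finally have "3 * (2 * card (edges ?H)) < 8 * card W"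
    using assms(4) finite_subset[OF assms(3)] by (simp add: field_simps card_gt_0_iff)
  moreover have "v \<rightarrow>\<^bsub>?H\<^esub> w \<longleftrightarrow> v \<rightarrow>\<^bsub>G\<^esub> w" if "v \<in> W" "w \<in> W" for v w
    using that by (auto simp: arcs_ends_def arc_to_ends_def)
  ultimately show ?thesis
    using sum_degrees_eq_edges[OF H] by (simp cong: conj_cong)
qed

section \<open>Cycles and distances\<close>

lemma (in wf_digraph) cas_nth:
  assumes "cas u p v"
  shows "Suc i < length p \<Longrightarrow> tail G (p ! Suc i) = head G (p ! i)"
    and "p \<noteq> [] \<Longrightarrow> tail G (p ! 0) = u \<and> head G (p ! (length p - 1)) = v"
  using assms
proof (induction p arbitrary: u i)
  case (Cons e p)
  {
    case 1
    then show ?case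
      using Cons.IH(1)[of "i - 1" "head G e"] Cons.IH(2)[of "head G e"] by (cases i) auto
  next
    case 2
    then show ?case
      using Cons.IH(2)[of "head G e"] by (cases p) auto
  }
qed auto

text \<open>Each vertex of an undirected cycle has its predecessor and its successor as two
  different neighbours, so the vertices of the cycle form a core.\<close>

lemma undirected_cycle_core:
  assumes "graph G" and p: "undirected_cycle (G \<restriction> F) p"
  shows "\<exists>T\<subseteq>F. core (\<lambda>v w. v \<rightarrow>\<^bsub>G\<^esub> w) T"
proof -
  interpret graph G by fact
  interpret H: wf_digraph "G \<restriction> F"
    by (rule wellformed_induce_subgraph)
  let ?n = "length p"
  obtain u where u: "H.awalk u p u" "distinct (tl (H.awalk_verts u p))" and n: "3 \<le> ?n"
    using p unfolding undirected_cycle_def H.cycle_def by blast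
  then have ne: "p \<noteq> []" and cas: "H.cas u p u" and arcs: "set p \<subseteq> arcs (G \<restriction> F)"
    by (auto simp: H.awalk_def)
  \<comment> \<open>After its start, the vertex list of a walk consists of the heads of its
    arcs.\<close>
  have dist: "distinct (map (head G) p)"
    using u(2) ne by (simp add: H.awalk_verts_conv'[OF cas])
  define nxt where "nxt i = (if Suc i = ?n then 0 else Suc i)" for i
  have nxt_less: "nxt i < ?n" if "i < ?n" for i
    using that by (auto simp: nxt_def)
  have tail_nxt: "tail G (p ! nxt i) = head G (p ! i)" if "i < ?n" for i
  proof (cases "Suc i = ?n")
    case True
    then have "?n - 1 = i"
      by simp
    then show ?thesis
      using H.cas_nth(2)[OF cas ne] True by (simp add: nxt_def)
  next
    case False
    then show ?thesis
      using H.cas_nth(1)[OF cas] that by (simp add: nxt_def)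
  qed
  have arc: "p ! i \<in> arcs G" "head G (p ! i) \<in> F" "tail G (p ! i) \<rightarrow>\<^bsub>G\<^esub> head G (p ! i)"
    if "i < ?n" for i
  proof -
    have "p ! i \<in> arcs (G \<restriction> F)"
      using arcs nth_mem[OF that] by blast
    then show "p ! i \<in> arcs G" "head G (p ! i) \<in> F" "tail G (p ! i) \<rightarrow>\<^bsub>G\<^esub> head G (p ! i)"
      by (auto simp: arcs_ends_def arc_to_ends_def)
  qed
  let ?T = "(\<lambda>i. head G (p ! i)) ` {..<?n}"
  have "core (\<lambda>v w. v \<rightarrow>\<^bsub>G\<^esub> w) ?T"
    unfolding core_def
  proof (intro conjI ballI)
    show "?T \<noteq> {}"
      using ne by auto
    fix v assume "v \<in> ?T"
    then obtain i where i: "i < ?n" "v = head G (p ! i)"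
      by auto
    \<comment> \<open>The cyclic predecessor of \<open>i\<close>; it differs from the successor
      because \<open>?n\<close> is at least 3.\<close>
    define j where "j = (if i = 0 then ?n - 1 else i - 1)"
    have j: "j < ?n" "nxt j = i" "j \<noteq> nxt i"
      using i n by (auto simp: j_def nxt_def)
    have "v \<rightarrow>\<^bsub>G\<^esub> head G (p ! nxt i)"
      using arc(3)[OF nxt_less[OF i(1)]] tail_nxt i by simp
    moreover have "v \<rightarrow>\<^bsub>G\<^esub> head G (p ! j)"
      using arc(3)[OF i(1)] tail_nxt[OF j(1)] j(2) i(2) graph_symmetric by simp
    moreover have "head G (p ! j) \<noteq> head G (p ! nxt i)"
      using nth_eq_iff_index_eq[OF dist, of j "nxt i"] j nxt_less[OF i(1)] by simp
    ultimately show "\<exists>a\<in>?T. \<exists>b\<in>?T. a \<noteq> b \<and> v \<rightarrow>\<^bsub>G\<^esub> a \<and> v \<rightarrow>\<^bsub>G\<^esub> b"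
      using j(1) nxt_less[OF i(1)] by blast
  qed
  moreover have "?T \<subseteq> F"
    using arc(2) by blast
  ultimately show ?thesis
    by blast
qed

text \<open>The hypotheses rule out walks with at most two arcs. The distance is an infimum over
  walks, so the bound 3 also covers the case of no walk.\<close>

lemma graph_dist_gt_2:
  assumes "wf_digraph G" "x \<noteq> y" "\<not> x \<rightarrow>\<^bsub>G\<^esub> y" "\<And>v. x \<rightarrow>\<^bsub>G\<^esub> v \<Longrightarrow> \<not> v \<rightarrow>\<^bsub>G\<^esub> y"
  shows "2 < graph_dist G x y"
proof -
  interpret wf_digraph G by fact
  have "3 \<le> awalk_cost (\<lambda>_. 1) p" if p: "awalk x p y" for p
  proof -
    have dom: "tail G e \<rightarrow>\<^bsub>G\<^esub> head G e" if "e \<in> arcs G" for e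
      using that by (auto simp: arcs_ends_def arc_to_ends_def)
    have "3 \<le> length p"
    proof (rule ccontr)
      assume "\<not> 3 \<le> length p"
      then consider "p = []" | e where "p = [e]" | e f where "p = [e, f]"
        by (cases p; cases "tl p"; cases "tl (tl p)") auto
      then show False
      proof cases
        case (3 e f)
        then have "x \<rightarrow>\<^bsub>G\<^esub> head G e" "head G e \<rightarrow>\<^bsub>G\<^esub> y"
          using p dom[of e] dom[of f] by (auto simp: awalk_def)
        then show False
          using assms(4) by blast
      qed (use p assms(2,3) dom in \<open>auto simp: awalk_def\<close>)
    qed
    then show ?thesis
      by (simp add: awalk_cost_def sum_list_triv)
  qed
  then have "3 \<le> graph_dist G x y"
    unfolding graph_dist_def \<mu>_def by (intro INF_greatest) auto
  then show ?thesis
    by (rule less_le_trans[rotated]) simp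
qed

theorem lemma12:
  fixes G :: "('a, 'b) pre_digraph"
  assumes "graph G"
    and "mad G < 8 / 3"
    and "girth G \<ge> 6"
  shows "\<exists>F I\<^sub>1 I\<^sub>2 I\<^sub>3.
    verts G = F \<union> I\<^sub>1 \<union> I\<^sub>2 \<union> I\<^sub>3 \<and>
    F \<inter> I\<^sub>1 = {} \<and> F \<inter> I\<^sub>2 = {} \<and> F \<inter> I\<^sub>3 = {} \<and>
    I\<^sub>1 \<inter> I\<^sub>2 = {} \<and> I\<^sub>1 \<inter> I\<^sub>3 = {} \<and> I\<^sub>2 \<inter> I\<^sub>3 = {} \<and>
    undirected_forest (G \<restriction> F) \<and>
    (\<forall>I \<in> {I\<^sub>1, I\<^sub>2, I\<^sub>3}. independent_set G I \<and>
       (\<forall>x\<in>I. \<forall>y\<in>I. x \<noteq> y \<longrightarrow> graph_dist G x y > 2))"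
proof -
  interpret graph G by fact
  obtain c where c: "good_colouring (\<lambda>v w. v \<rightarrow>\<^bsub>G\<^esub> w) (verts G) c"
    using sparse_good_colouring[of "verts G" "\<lambda>v w. v \<rightarrow>\<^bsub>G\<^esub> w"]
      graph_symmetric adj_not_same induced_degrees_less[OF assms(1,2)] by auto
  define C where "C k = {v \<in> verts G. c v = k}" for k
  have "c v \<in> {0, 1, 2, 3}" if "v \<in> verts G" for v
  proof -
    have "c v \<le> 3"
      using c that by (simp add: good_colouring_def)
    then show ?thesis
      by auto
  qed
  then have cover: "verts G = C 0 \<union> C 1 \<union> C 2 \<union> C 3"
    unfolding C_def by blast
  have disj: "C k \<inter> C l = {}" if "k \<noteq> l" for k l
    using that by (auto simp: C_def)
  have "\<not> undirected_cycle (G \<restriction> C 0) p" for p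
  proof
    assume "undirected_cycle (G \<restriction> C 0) p"
    then obtain T where "T \<subseteq> C 0" "core (\<lambda>v w. v \<rightarrow>\<^bsub>G\<^esub> w) T"
      using undirected_cycle_core[OF assms(1)] by blast
    then show False
      using c unfolding good_colouring_def C_def by blast
  qed
  then have forest: "undirected_forest (G \<restriction> C 0)"
    by (simp add: undirected_forest_def)
  have indep: "independent_set G (C k) \<and> (\<forall>x\<in>C k. \<forall>y\<in>C k. x \<noteq> y \<longrightarrow> 2 < graph_dist G x y)"
    if "k \<noteq> 0" for k
  proof -
    have near: "c x \<noteq> c y"
      if "x \<in> verts G" "y \<in> verts G" "x \<noteq> y" "c x \<noteq> 0"
        "x \<rightarrow>\<^bsub>G\<^esub> y \<or> (\<exists>v\<in>verts G. x \<rightarrow>\<^bsub>G\<^esub> v \<and> v \<rightarrow>\<^bsub>G\<^esub> y)" for x y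
      using c that unfolding good_colouring_def by blast
    have far: "\<not> x \<rightarrow>\<^bsub>G\<^esub> y" "x \<rightarrow>\<^bsub>G\<^esub> v \<Longrightarrow> \<not> v \<rightarrow>\<^bsub>G\<^esub> y"
      if xy: "x \<in> C k" "y \<in> C k" "x \<noteq> y" for x y v
      using near[of x y] xy \<open>k \<noteq> 0\<close> adj_in_verts unfolding C_def by auto
    have "independent_set G (C k)"
      using far(1) adj_not_same unfolding independent_set_def C_def by blast
    moreover have "2 < graph_dist G x y" if "x \<in> C k" "y \<in> C k" "x \<noteq> y" for x y
      by (rule graph_dist_gt_2[OF wf_digraph_axioms that(3)]) (use far that in blast)+
    ultimately show ?thesis
      by blast
  qed
  show ?thesis
    by (rule exI[of _ "C 0"], rule exI[of _ "C 1"], rule exI[of _ "C 2"], rule exI[of _ "C 3"])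
      (use cover disj forest indep[of 1] indep[of 2] indep[of 3] in auto)
qed

end
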